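(* Let $p\ge 5$ be a prime and let $n:=2^{p-1}$. Let $\phi_k(m)$ (for even integers $m\ge 0$ and integers $k\ge 0$) be the integers determined by the double index recurrence relation $$\phi_k(m)=4\,\phi_{k-1}(m-2)-\phi_k(m-4)\qquad (k\ge 2,\ m\ge 4 \text{ even},\ k\le m/2),$$ the convention $\phi_k(m)=0$ for $k>m/2$, and the boundary values $$\phi_0(m)=\begin{cases}+2 & m\equiv 0 \pmod 8\\ 0 & m\equiv \pm 2\pmod 8\\ -2 & m\equiv 4\pmod 8\end{cases},\qquad \phi_1(m)=\begin{cases}+2m & m\equiv 2\pmod 8\\ 0 & m\equiv 0,4\pmod 8\\ -2m & m\equiv 6\pmod 8.\end{cases}$$ Then $2^p-1$ is prime if and only if $$2n-1\ \Big|\ \sum_{\substack{0\le k\le \lfloor n/2\rfloor\\ k\text{ even}}}\phi_k(n).$$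
   Context: Divisibility is divisibility of integers. Note that $2n-1=2^p-1$. *)

theory Defs
  imports Complex_Main "HOL-Computational_Algebra.Primes"
begin

(* \<phi>\<^sub>k(m) is "phi k m". It is only meant for even m; on odd m it takes the junk value 0.
   In the last branch 2 \<le> k \<le> m div 2, hence m \<ge> 4 and no natural-number subtraction truncates. *)
fun phi :: "nat \<Rightarrow> nat \<Rightarrow> int" where
  "phi k m =
    (if odd m \<or> k > m div 2 then 0
     else if k = 0 then
       (if m mod 8 = 0 then 2 else if m mod 8 = 4 then - 2 else 0)
     else if k = 1 then
       (if m mod 8 = 2 then 2 * int m else if m mod 8 = 6 then - 2 * int m else 0)
     else 4 * phi (k - 1) (m - 2) - phi k (m - 4))"

declare phi.simps [simp del]

lemma phi_eq_0: "k > m div 2 \<Longrightarrow> phi k m = 0"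
  by (simp add: phi.simps)

lemma phi_0:
  assumes "even m"
  shows "phi 0 m = (if m mod 8 = 0 then 2 else if m mod 8 = 4 then - 2 else 0)"
  using assms by (simp add: phi.simps)

(* No side condition m \<ge> 2 is needed: at m = 0 the convention and the boundary formula both give 0. *)
lemma phi_1:
  assumes "even m"
  shows "phi 1 m = (if m mod 8 = 2 then 2 * int m else if m mod 8 = 6 then - 2 * int m else 0)"
  using assms by (cases "m = 0") (auto simp: phi.simps elim!: evenE)

lemma phi_rec:
  assumes "even m" "m \<ge> 4" "k \<ge> 2" "k \<le> m div 2"
  shows "phi k m = 4 * phi (k - 1) (m - 2) - phi k (m - 4)"
  using assms by (subst phi.simps) auto

(* The convention, the boundary values and the recurrence determine phi on even m. *)
lemma phi_unique:
  fixes f :: "nat \<Rightarrow> nat \<Rightarrow> int"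
  assumes conv: "\<And>k m. even m \<Longrightarrow> k > m div 2 \<Longrightarrow> f k m = 0"
    and f0: "\<And>m. even m \<Longrightarrow>
      f 0 m = (if m mod 8 = 0 then 2 else if m mod 8 = 4 then - 2 else 0)"
    and f1: "\<And>m. even m \<Longrightarrow>
      f 1 m = (if m mod 8 = 2 then 2 * int m else if m mod 8 = 6 then - 2 * int m else 0)"
    and frec: "\<And>k m. even m \<Longrightarrow> m \<ge> 4 \<Longrightarrow> k \<ge> 2 \<Longrightarrow> k \<le> m div 2 \<Longrightarrow>
      f k m = 4 * f (k - 1) (m - 2) - f k (m - 4)"
    and "even m"
  shows "f k m = phi k m"
  using \<open>even m\<close>
proof (induction m arbitrary: k rule: less_induct)
  case (less m)
  consider "k > m div 2" | "k = 0" | "k = 1" | "k \<ge> 2" "k \<le> m div 2"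
    by linarith
  then show ?case
  proof cases
    case 1
    then show ?thesis using less.prems by (simp add: conv phi_eq_0)
  next
    case 2
    then show ?thesis using less.prems by (simp only: f0 phi_0)
  next
    case 3
    then show ?thesis using less.prems by (simp only: f1 phi_1)
  next
    case 4
    then have "m \<ge> 4" by linarith
    then show ?thesis
      using less 4 by (simp add: frec phi_rec)
  qed
qed

end

theory Submission
  imports Defs "HOL-Number_Theory.Number_Theory"
begin

text \<open>
  This is the Lucas--Lehmer test in disguise. Put $F_j = \sum_k \phi_k(2j)$. Summing the recurrence
  over $k$ gives $F_{j+2} = 4 F_{j+1} - F_j$ with $F_0 = 2$ and $F_1 = 4$, so
  $F_j = \omega^j + \bar\omega^j$, where $\omega = 2 + \sqrt 3$ and $\bar\omega = 2 - \sqrt 3$ are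
  the roots of $x^2 - 4x + 1$ (\<open>sum_phi_eq_trace\<close>). Since $\phi_k(2j)$ vanishes unless $k$ and
  $j$ have the same parity, for even $j$ the sum over even $k$ is all of $F_j$. As
  $\omega\bar\omega = 1$, we have $\omega^j F_j = \omega^{2j} + 1$ with $\omega^j$ a unit; with
  $j = n/2$ the divisibility in question says exactly that $\omega^{2^{p-1}} \equiv -1$ modulo
  $M = 2^p - 1$ in $\mathbb{Z}[\sqrt 3]$ (\<open>dvd_even_sum_phi_iff\<close>).

  If this congruence holds, then it also holds modulo every divisor $q > 1$ of the odd number $M$,
  and then $\omega$ has order exactly $2^p$ modulo $q$. The residue ring has only $q^2$ elements, so
  $q^2 \ge 2^p > M$ (\<open>order_bound\<close>). A composite $M$ would have a divisor $q > 1$ with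
  $q^2 \le M$.

  Conversely, let $M$ be prime. It is $3$ modulo $4$ and $1$ modulo $3$, so by quadratic reciprocity
  and Euler's criterion $3^{(M-1)/2} \equiv -1$, that is, $(\sqrt 3)^M \equiv -\sqrt 3$. Hence
  $(1 + \sqrt 3)^M \equiv 1 - \sqrt 3$ and $(1 + \sqrt 3)^{M+1} \equiv -2$. On the other hand
  $(1 + \sqrt 3)^2 = 2\omega$ and $(M + 1)/2 = 2^{p-1}$, so this power is
  $2^{2^{p-1}} \omega^{2^{p-1}} \equiv 2 \omega^{2^{p-1}}$. Cancelling $2$ gives the congruence
  (\<open>omega_power_if_mersenne_prime\<close>).
\<close>

section \<open>The ring of integers with a square root of three\<close>

text \<open>
  Pairs of integers rather than real numbers $a + b\sqrt 3$: the residue of an element modulo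
  an integer can then be read off from its two coordinates.
\<close>

datatype zsqrt3 = ZSqrt3 (rat_part: int) (root_part: int)

lemma zsqrt3_eq_iff: "x = y \<longleftrightarrow> rat_part x = rat_part y \<and> root_part x = root_part y"
  by (cases x; cases y) auto

instantiation zsqrt3 :: comm_ring_1
begin

definition "0 = ZSqrt3 0 0"
definition "1 = ZSqrt3 1 0"
definition "x + y = ZSqrt3 (rat_part x + rat_part y) (root_part x + root_part y)"
definition "- x = ZSqrt3 (- rat_part x) (- root_part x)"
definition "x - y = ZSqrt3 (rat_part x - rat_part y) (root_part x - root_part y)"
definition "x * y = ZSqrt3
  (rat_part x * rat_part y + 3 * (root_part x * root_part y))
  (rat_part x * root_part y + root_part x * rat_part y)"

instance
  by standard
    (auto simp: zsqrt3_eq_iff zero_zsqrt3_def one_zsqrt3_def plus_zsqrt3_def uminus_zsqrt3_def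
      minus_zsqrt3_def times_zsqrt3_def algebra_simps)

end

lemma zsqrt3_parts [simp]:
  "rat_part 0 = 0" "root_part 0 = 0"
  "rat_part 1 = 1" "root_part 1 = 0"
  "rat_part (x + y) = rat_part x + rat_part y" "root_part (x + y) = root_part x + root_part y"
  "rat_part (- x) = - rat_part x" "root_part (- x) = - root_part x"
  "rat_part (x - y) = rat_part x - rat_part y" "root_part (x - y) = root_part x - root_part y"
  "rat_part (x * y) = rat_part x * rat_part y + 3 * (root_part x * root_part y)"
  "root_part (x * y) = rat_part x * root_part y + root_part x * rat_part y"
  by (simp_all add: zero_zsqrt3_def one_zsqrt3_def plus_zsqrt3_def uminus_zsqrt3_def
      minus_zsqrt3_def times_zsqrt3_def)

lemma parts_of_nat [simp]: "rat_part (of_nat n) = int n" "root_part (of_nat n) = 0"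
  by (induction n) auto

lemma parts_of_int [simp]: "rat_part (of_int a) = a" "root_part (of_int a) = 0"
  by (cases a rule: int_diff_cases; simp)+

lemma parts_numeral [simp]: "rat_part (numeral w) = numeral w" "root_part (numeral w) = 0"
  using parts_of_int[of "numeral w"] by simp_all

lemma of_int_dvd_zsqrt3_iff:
  "of_int N dvd z \<longleftrightarrow> N dvd rat_part z \<and> N dvd root_part z"
proof
  assume "of_int N dvd z"
  then show "N dvd rat_part z \<and> N dvd root_part z"
    by (auto elim!: dvdE)
next
  assume "N dvd rat_part z \<and> N dvd root_part z"
  then obtain a b where "rat_part z = N * a" "root_part z = N * b"
    by (auto elim!: dvdE)
  then have "z = of_int N * ZSqrt3 a b"
    by (simp add: zsqrt3_eq_iff)
  then show "of_int N dvd z"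
    by simp
qed

definition root3 :: zsqrt3 where "root3 = ZSqrt3 0 1"

text \<open>The fundamental unit of the ring and, below, its inverse, which is also its conjugate.\<close>

definition omega :: zsqrt3 where "omega = 2 + root3"

definition omega_conj :: zsqrt3 where "omega_conj = 2 - root3"

lemma root3_square: "root3 ^ 2 = 3"
  by (simp add: root3_def zsqrt3_eq_iff power2_eq_square)

lemma omega_mult_conj: "omega * omega_conj = 1"
  by (simp add: root3_def omega_def omega_conj_def zsqrt3_eq_iff)

lemma omega_power_mult_conj_power: "omega ^ j * omega_conj ^ j = 1"
  by (simp add: omega_mult_conj flip: power_mult_distrib)

text \<open>
  Although $\omega$ is not a square in the ring, $2\omega$ is. This is what lets the Frobenius map
  compute the power of $\omega$ with exponent $(M + 1)/2$ rather than only $M + 1$.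
\<close>

lemma one_plus_root3_square: "(1 + root3) ^ 2 = 2 * omega"
  by (simp add: root3_def omega_def zsqrt3_eq_iff power2_eq_square)

section \<open>Congruences modulo an integer\<close>

definition eq_mod :: "int \<Rightarrow> zsqrt3 \<Rightarrow> zsqrt3 \<Rightarrow> bool" where
  "eq_mod N x y \<longleftrightarrow> of_int N dvd x - y"

lemma eq_mod_trans [trans]: "eq_mod N x y \<Longrightarrow> eq_mod N y z \<Longrightarrow> eq_mod N x z"
  unfolding eq_mod_def using dvd_add[of "of_int N" "x - y" "y - z"] by simp

lemma eq_mod_refl [simp]: "eq_mod N x x"
  by (simp add: eq_mod_def)

lemma eq_mod_sym: "eq_mod N x y \<Longrightarrow> eq_mod N y x"
  unfolding eq_mod_def using dvd_minus_iff[of "of_int N" "x - y"] by simp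

lemma eq_mod_add: "eq_mod N x y \<Longrightarrow> eq_mod N x' y' \<Longrightarrow> eq_mod N (x + x') (y + y')"
  unfolding eq_mod_def using dvd_add[of "of_int N" "x - y" "x' - y'"]
  by (simp add: algebra_simps)

lemma eq_mod_mult:
  assumes "eq_mod N x y" "eq_mod N x' y'"
  shows "eq_mod N (x * x') (y * y')"
proof -
  have "x * x' - y * y' = (x - y) * x' + y * (x' - y')"
    by (simp add: algebra_simps)
  then show ?thesis
    using assms by (simp add: eq_mod_def)
qed

lemma eq_mod_power: "eq_mod N x y \<Longrightarrow> eq_mod N (x ^ k) (y ^ k)"
  by (induction k) (auto intro: eq_mod_mult)

lemma eq_mod_of_int_iff: "eq_mod N (of_int a) (of_int b) \<longleftrightarrow> [a = b] (mod N)"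
  by (simp add: eq_mod_def of_int_dvd_zsqrt3_iff cong_iff_dvd_diff)

lemma eq_mod_dvd_mono: "eq_mod N x y \<Longrightarrow> q dvd N \<Longrightarrow> eq_mod q x y"
  by (auto simp: eq_mod_def of_int_dvd_zsqrt3_iff)

text \<open>
  The binomial coefficients strictly between the ends are divisible by the prime, so raising to that
  power is additive modulo it.
\<close>

lemma eq_mod_prime_power_add:
  assumes "prime q"
  shows "eq_mod (int q) ((x + y) ^ q) (x ^ q + y ^ q)"
proof -
  have q: "q > 0"
    using assms by (simp add: prime_gt_0_nat)
  have "(x + y) ^ q = (\<Sum>k\<le>q. of_nat (q choose k) * x ^ k * y ^ (q - k))"
    by (rule binomial_ring)
  also have "{..q} = insert 0 (insert q {0<..<q})"
    by auto
  also have "(\<Sum>k\<in>\<dots>. of_nat (q choose k) * x ^ k * y ^ (q - k)) =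
      x ^ q + y ^ q + (\<Sum>k\<in>{0<..<q}. of_nat (q choose k) * x ^ k * y ^ (q - k))"
    using q by simp
  finally have *: "(x + y) ^ q - (x ^ q + y ^ q) =
      (\<Sum>k\<in>{0<..<q}. of_nat (q choose k) * x ^ k * y ^ (q - k))"
    by simp
  have "of_int (int q) dvd of_nat (q choose k) * x ^ k * y ^ (q - k)" if "k \<in> {0<..<q}" for k
  proof -
    have "q dvd (q choose k)"
      using that assms by (intro dvd_choose_prime) auto
    then have "(of_nat q :: zsqrt3) dvd of_nat (q choose k)"
      by (auto elim!: dvdE)
    then show ?thesis
      by (simp add: mult.assoc)
  qed
  then show ?thesis
    unfolding eq_mod_def * by (intro dvd_sum) auto
qed

section \<open>The sums as traces of powers of the fundamental unit\<close>

lemma double_mod_8_iff: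
  fixes j :: nat
  shows "2 * j mod 8 = 0 \<longleftrightarrow> j mod 4 = 0" "2 * j mod 8 = 2 \<longleftrightarrow> j mod 4 = 1"
    "2 * j mod 8 = 4 \<longleftrightarrow> j mod 4 = 2" "2 * j mod 8 = 6 \<longleftrightarrow> j mod 4 = 3"
  by presburger+

lemma add_mod_4_iff:
  fixes j :: nat
  shows "(j + 2) mod 4 = 0 \<longleftrightarrow> j mod 4 = 2" "(j + 2) mod 4 = 1 \<longleftrightarrow> j mod 4 = 3"
    "(j + 2) mod 4 = 2 \<longleftrightarrow> j mod 4 = 0" "(j + 2) mod 4 = 3 \<longleftrightarrow> j mod 4 = 1"
    "(j + 1) mod 4 = 0 \<longleftrightarrow> j mod 4 = 3" "(j + 1) mod 4 = 2 \<longleftrightarrow> j mod 4 = 1"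
  by presburger+

lemma phi_0_double:
  "phi 0 (2 * j) = (if j mod 4 = 0 then 2 else if j mod 4 = 2 then - 2 else 0)"
  by (subst phi_0) (simp_all add: double_mod_8_iff)

lemma phi_1_double:
  "phi 1 (2 * j) = (if j mod 4 = 1 then 4 * int j else if j mod 4 = 3 then - 4 * int j else 0)"
  by (subst phi_1) (simp_all add: double_mod_8_iff)

lemma phi_0_double_rec: "phi 0 (2 * (j + 2)) = - phi 0 (2 * j)"
  unfolding phi_0_double add_mod_4_iff by simp

text \<open>
  The recurrence extends beyond the range in which it defines \<^const>\<open>phi\<close>: for $k = 1$ it is a
  property of the boundary values, and for $k > j + 2$ all three terms vanish. Only $k = 0$ is
  different, where the term with index $k - 1$ has to be dropped.
\<close>

lemma phi_double_rec:
  assumes "k > 0"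
  shows "phi k (2 * (j + 2)) = 4 * phi (k - 1) (2 * (j + 1)) - phi k (2 * j)"
proof -
  consider "k = 1" | "k \<ge> 2" "k \<le> j + 2" | "k > j + 2"
    using assms by linarith
  then show ?thesis
  proof cases
    case 1
    show ?thesis
      unfolding 1 phi_1_double diff_self_eq_0 phi_0_double add_mod_4_iff by simp
  next
    case 2
    then show ?thesis
      using phi_rec[of "2 * (j + 2)" k] by simp
  next
    case 3
    then show ?thesis
      by (simp add: phi_eq_0)
  qed
qed

lemma sum_phi_rec:
  "(\<Sum>k\<le>j + 2. phi k (2 * (j + 2))) =
    4 * (\<Sum>k\<le>j + 1. phi k (2 * (j + 1))) - (\<Sum>k\<le>j. phi k (2 * j))"
proof -
  have "(\<Sum>k\<le>j + 2. phi k (2 * (j + 2))) =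
      phi 0 (2 * (j + 2)) + (\<Sum>k\<le>j + 1. phi (Suc k) (2 * (j + 2)))"
    using sum.atMost_Suc_shift[of "\<lambda>k. phi k (2 * (j + 2))" "j + 1"] by simp
  also have "\<dots> = - phi 0 (2 * j) +
      (\<Sum>k\<le>j + 1. 4 * phi k (2 * (j + 1)) - phi (Suc k) (2 * j))"
    unfolding phi_0_double_rec
    by (subst phi_double_rec) auto
  also have "\<dots> = 4 * (\<Sum>k\<le>j + 1. phi k (2 * (j + 1))) -
      (phi 0 (2 * j) + (\<Sum>k\<le>j + 1. phi (Suc k) (2 * j)))"
    by (simp only: sum_subtractf sum_distrib_left)
  also have "phi 0 (2 * j) + (\<Sum>k\<le>j + 1. phi (Suc k) (2 * j)) = (\<Sum>k\<le>j + 2. phi k (2 * j))"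
    using sum.atMost_Suc_shift[of "\<lambda>k. phi k (2 * j)" "j + 1"] by simp
  also have "\<dots> = (\<Sum>k\<le>j. phi k (2 * j))"
    by (rule sum.mono_neutral_right) (auto simp: phi_eq_0)
  finally show ?thesis .
qed

text \<open>
  Both sides satisfy the same second-order recurrence, since \<^const>\<open>omega\<close> and \<^const>\<open>omega_conj\<close>
  are the roots of $x^2 - 4x + 1$.
\<close>

lemma sum_phi_eq_trace:
  "of_int (\<Sum>k\<le>j. phi k (2 * j)) = omega ^ j + omega_conj ^ j"
proof (induction j rule: less_induct)
  case (less j)
  consider "j = 0" | "j = 1" | i where "j = i + 2"
    by (metis One_nat_def add_2_eq_Suc' not0_implies_Suc)
  then show ?case
  proof cases
    case 1
    then show ?thesis
      using phi_0[of 0] by simp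
  next
    case 2
    then show ?thesis
      using phi_0[of 2] phi_1[of 2] by (simp add: omega_def omega_conj_def)
  next
    case 3
    have "omega ^ 2 = 4 * omega - 1" "omega_conj ^ 2 = 4 * omega_conj - 1"
      by (simp_all add: omega_def omega_conj_def root3_def zsqrt3_eq_iff power2_eq_square)
    then have "omega ^ i * omega ^ 2 + omega_conj ^ i * omega_conj ^ 2 =
        4 * (omega ^ (i + 1) + omega_conj ^ (i + 1)) - (omega ^ i + omega_conj ^ i)"
      by (simp only: power_add power_one_right) (simp add: algebra_simps)
    then have "omega ^ (i + 2) + omega_conj ^ (i + 2) =
        4 * (omega ^ (i + 1) + omega_conj ^ (i + 1)) - (omega ^ i + omega_conj ^ i)"
      by (simp only: power_add)
    then show ?thesis
      using less[of i] less[of "i + 1"] sum_phi_rec[of i] 3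
      by (simp only: of_int_diff of_int_mult of_int_numeral)
  qed
qed

text \<open>
  The recurrence couples only pairs $(k, j)$ with the same parity of $k + j$, and the boundary values
  with $k + j$ odd are zero. For even $j$, the odd indices $k$ can therefore be added to the sum
  without changing it.
\<close>

lemma phi_double_eq_0_if_odd: "odd (k + j) \<Longrightarrow> phi k (2 * j) = 0"
proof (induction j arbitrary: k rule: less_induct)
  case (less j)
  consider "k = 0" | "k > j" | "j = 1" "k = 1" | "j \<ge> 2" "k > 0"
    by linarith
  then show ?case
  proof cases
    case 1
    then have "j mod 4 \<noteq> 0" "j mod 4 \<noteq> 2"
      using less.prems by presburger+
    then show ?thesis
      using 1 by (simp add: phi_0_double)
  next
    case 2
    then show ?thesis
      by (simp add: phi_eq_0)
  next
    case 3
    then show ?thesis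
      using less.prems by simp
  next
    case 4
    define i where "i = j - 2"
    have i: "j = i + 2"
      using 4 by (simp add: i_def)
    have "phi (k - 1) (2 * (i + 1)) = 0"
      by (rule less.IH) (use less.prems i 4 in auto)
    moreover have "phi k (2 * i) = 0"
      by (rule less.IH) (use less.prems i in auto)
    ultimately show ?thesis
      unfolding i phi_double_rec[OF 4(2)] by simp
  qed
qed

text \<open>
  Multiplying the trace $\omega^j + \bar\omega^j$ by the unit $\omega^j$ gives $\omega^{2j} + 1$.
\<close>

lemma dvd_even_sum_phi_iff:
  assumes "even j"
  shows "N dvd (\<Sum>k | k \<le> j \<and> even k. phi k (2 * j)) \<longleftrightarrow> eq_mod N (omega ^ (2 * j)) (- 1)"
proof -
  have "(\<Sum>k | k \<le> j \<and> even k. phi k (2 * j)) = (\<Sum>k\<le>j. phi k (2 * j))"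
    by (rule sum.mono_neutral_left) (use assms phi_double_eq_0_if_odd in auto)
  then have "N dvd (\<Sum>k | k \<le> j \<and> even k. phi k (2 * j)) \<longleftrightarrow>
      of_int N dvd omega ^ j + omega_conj ^ j"
    by (simp only: of_int_dvd_zsqrt3_iff parts_of_int dvd_0_right simp_thms flip: sum_phi_eq_trace)
  also have "\<dots> \<longleftrightarrow> of_int N dvd omega ^ (2 * j) + 1"
  proof
    assume "of_int N dvd omega ^ j + omega_conj ^ j"
    then have "of_int N dvd omega ^ j * (omega ^ j + omega_conj ^ j)"
      by (rule dvd_mult)
    then show "of_int N dvd omega ^ (2 * j) + 1"
      by (simp add: distrib_left omega_power_mult_conj_power mult_2 power_add)
  next
    assume "of_int N dvd omega ^ (2 * j) + 1"
    then have "of_int N dvd omega_conj ^ j * (omega ^ (2 * j) + 1)"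
      by (rule dvd_mult)
    also have "omega_conj ^ j * (omega ^ (2 * j) + 1) =
        omega ^ j * (omega ^ j * omega_conj ^ j) + omega_conj ^ j"
      by (simp only: mult_2 power_add) (simp add: algebra_simps)
    finally show "of_int N dvd omega ^ j + omega_conj ^ j"
      by (simp add: omega_power_mult_conj_power)
  qed
  finally show ?thesis
    by (simp add: eq_mod_def)
qed

section \<open>Sufficiency: the order of the unit forces a large residue ring\<close>

text \<open>
  Write $d = 2^r c$ with $c$ odd; the bound on $d$ forces $r \le m$. Raising $\omega^d \equiv 1$ to
  the power $2^{m-r}$ gives $1 \equiv (\omega^{2^m})^c \equiv (-1)^c = -1$, so $q$ would divide $2$.
\<close>

lemma omega_power_not_1:
  assumes "eq_mod q (omega ^ (2 ^ m)) (- 1)" "0 < d" "d < 2 ^ (m + 1)" "\<not> q dvd 2"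
  shows "\<not> eq_mod q (omega ^ d) 1"
proof
  assume d: "eq_mod q (omega ^ d) 1"
  obtain r c where rc: "d = c * 2 ^ r" "odd c"
    using prime_power_canonical[OF two_is_prime_nat \<open>0 < d\<close>] by auto
  have "(2::nat) ^ r \<le> d"
    using rc \<open>0 < d\<close> by auto
  then have "(2::nat) ^ r < 2 ^ (m + 1)"
    using assms(3) by linarith
  then have "r \<le> m"
    by (simp add: power_strict_increasing_iff del: power_Suc)
  then have *: "d * 2 ^ (m - r) = 2 ^ m * c"
    using rc by (simp add: mult.assoc flip: power_add)
  have "eq_mod q 1 ((omega ^ d) ^ (2 ^ (m - r)))"
    using eq_mod_power[OF d, of "2 ^ (m - r)"] by (simp add: eq_mod_sym)
  also have "(omega ^ d) ^ (2 ^ (m - r)) = (omega ^ (2 ^ m)) ^ c"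
    by (simp only: * flip: power_mult)
  also have "eq_mod q \<dots> ((- 1) ^ c)"
    by (rule eq_mod_power) fact
  finally have "eq_mod q 1 (- 1)"
    using rc by simp
  then show False
    using assms(4) by (simp add: eq_mod_def of_int_dvd_zsqrt3_iff)
qed

text \<open>
  The first $2^{m+1}$ powers of the unit are pairwise incongruent by the previous lemma, and each is
  determined modulo $q$ by a pair of residues, so there are at most $q^2$ of them.
\<close>

lemma order_bound:
  assumes "eq_mod q (omega ^ (2 ^ m)) (- 1)" "q > 0" "\<not> q dvd 2"
  shows "2 ^ (m + 1) \<le> q ^ 2"
proof -
  define f where "f i = (rat_part (omega ^ i) mod q, root_part (omega ^ i) mod q)" for i
  have f_eq: "f i = f j \<longleftrightarrow> eq_mod q (omega ^ i) (omega ^ j)" for i j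
    by (simp add: f_def eq_mod_def of_int_dvd_zsqrt3_iff mod_eq_dvd_iff)
  have neq: "f i \<noteq> f j" if "i < j" "j < 2 ^ (m + 1)" for i j
  proof
    assume "f i = f j"
    then have "eq_mod q (omega ^ j * omega_conj ^ i) (omega ^ i * omega_conj ^ i)"
      by (auto simp: f_eq intro: eq_mod_mult eq_mod_sym)
    moreover have "omega ^ j * omega_conj ^ i = omega ^ (j - i) * (omega ^ i * omega_conj ^ i)"
      using \<open>i < j\<close> by (simp flip: mult.assoc power_add)
    ultimately have "eq_mod q (omega ^ (j - i)) 1"
      by (simp add: omega_power_mult_conj_power)
    moreover have "0 < j - i" "j - i < 2 ^ (m + 1)"
      using that by linarith+
    ultimately show False
      using omega_power_not_1[OF assms(1) _ _ assms(3), of "j - i"] by blast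
  qed
  have "inj_on f {..<2 ^ (m + 1)}"
    by (intro inj_onI) (metis lessThan_iff linorder_neqE_nat neq)
  moreover have "f ` {..<2 ^ (m + 1)} \<subseteq> {0..<q} \<times> {0..<q}"
    using assms(2) by (auto simp: f_def)
  ultimately have "card {..<(2::nat) ^ (m + 1)} \<le> card ({0..<q} \<times> {0..<q})"
    by (rule card_inj_on_le) simp
  then have "2 ^ (m + 1) \<le> nat q * nat q"
    by (simp add: card_cartesian_product)
  then have "int (2 ^ (m + 1)) \<le> int (nat q * nat q)"
    by (simp only: of_nat_le_iff)
  then show ?thesis
    using assms(2) by (simp add: power2_eq_square)
qed

lemma mersenne_prime_if_omega_power:
  assumes "p \<ge> 2" and "eq_mod (2 ^ p - 1) (omega ^ (2 ^ (p - 1))) (- 1)"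
  shows "prime ((2::nat) ^ p - 1)"
proof (rule ccontr)
  define M :: nat where "M = 2 ^ p - 1"
  have "(2::nat) ^ 2 \<le> 2 ^ p"
    using assms(1) by (intro power_increasing) auto
  then have M: "M > 1" "int M = 2 ^ p - 1"
    by (auto simp: M_def of_nat_diff)
  assume "\<not> prime ((2::nat) ^ p - 1)"
  then obtain a where a: "a dvd M" "a \<noteq> 1" "a \<noteq> M"
    using M(1) by (auto simp: M_def prime_nat_iff)
  then obtain b where ab: "M = a * b"
    by (elim dvdE)
  have "a > 1" "b > 1"
    using a ab M(1) by (cases a; cases b; force)+
  define q where "q = min a b"
  have q: "q > 1" "q dvd M" "q ^ 2 \<le> M"
    using \<open>a > 1\<close> \<open>b > 1\<close> ab by (auto simp: q_def min_def power2_eq_square)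
  have "odd M"
    using assms(1) by (simp add: M_def)
  have "\<not> q dvd 2"
  proof
    assume "q dvd 2"
    then have "q = 2"
      using \<open>q > 1\<close> dvd_imp_le[of q 2] by auto
    then show False
      using \<open>odd M\<close> q by simp
  qed
  then have "\<not> int q dvd 2"
    by (metis int_dvd_int_iff of_nat_numeral)
  moreover have "eq_mod (int q) (omega ^ (2 ^ (p - 1))) (- 1)"
    by (rule eq_mod_dvd_mono[OF assms(2)[folded M(2)]]) (use q in simp)
  moreover have "int q > 0"
    using q by simp
  ultimately have "2 ^ (p - 1 + 1) \<le> int q ^ 2"
    by (intro order_bound)
  moreover have "int q ^ 2 \<le> int M"
    using q(3) by (metis of_nat_le_iff of_nat_power)
  ultimately show False
    using assms(1) M by simp
qed

section \<open>Necessity: the Frobenius map modulo a Mersenne prime\<close>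

lemma mersenne_mod_3:
  assumes "odd p"
  shows "(2 ^ p - 1) mod 3 = (1::int)"
proof -
  have "[(2::int) ^ p = (- 1) ^ p] (mod 3)"
    by (intro cong_pow) (simp add: cong_def)
  then have "[(2::int) ^ p - 1 = (- 1) ^ p - 1] (mod 3)"
    by (intro cong_diff) auto
  then show ?thesis
    using assms by (simp add: cong_def)
qed

text \<open>
  Both $3$ and $M$ are $3$ modulo $4$, so reciprocity reverses the sign: $M \equiv 1$ is a square
  modulo $3$, hence $3$ is not a square modulo $M$.
\<close>

lemma three_power_mod_mersenne:
  fixes p :: nat
  defines "M \<equiv> 2 ^ p - 1"
  assumes "prime M" "odd p" "p \<ge> 3"
  shows "[3 ^ ((M - 1) div 2) = - 1] (mod int M)"
proof -
  have "(2::nat) ^ 3 \<le> 2 ^ p"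
    using assms by (intro power_increasing) auto
  then have M: "M > 3" "int M = 2 ^ p - 1"
    by (auto simp: M_def of_nat_diff)
  have "(M - 1) div 2 = 2 ^ (p - 1) - 1"
    using assms by (cases p) (auto simp: M_def)
  then have odd: "odd ((M - 1) div 2)"
    using assms by simp
  have M3: "int M mod 3 = 1"
    using mersenne_mod_3[OF \<open>odd p\<close>] M by simp
  then have "QuadRes 3 (int M)"
    unfolding QuadRes_def by (intro exI[of _ 1]) (simp add: cong_def)
  then have "Legendre (int M) 3 = 1"
    using M3 by (simp add: Legendre_def cong_def)
  moreover have "Legendre (int 3) (int M) * Legendre (int M) (int 3) =
      (- 1) ^ ((3 - 1) div 2 * ((M - 1) div 2))"
    by (rule Quadratic_Reciprocity) (use assms M in auto)
  ultimately have "Legendre 3 (int M) = - 1"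
    using odd by simp
  then show ?thesis
    using euler_criterion[of M 3] assms M by (simp add: cong_sym)
qed

text \<open>
  The order of $2$ modulo $2^p - 1$ divides $p$, and $p$ divides $2^{p-1} - 1$ by Fermat's theorem,
  so the exponent can be reduced to $1$.
\<close>

lemma two_power_mod_mersenne:
  assumes "prime p" "p > 2"
  shows "[2 ^ 2 ^ (p - 1) = 2] (mod (2 ^ p - 1 :: int))"
proof -
  have "odd p"
    using assms prime_odd_nat by auto
  then have "\<not> p dvd 2"
    using assms by (metis dvd_imp_le linorder_not_less zero_less_numeral)
  then have "[2 ^ (p - 1) = 1] (mod p)"
    using assms(1) by (rule fermat_theorem[rotated])
  then have "p dvd 2 ^ (p - 1) - 1"
    by (rule cong_to_1_nat)
  then obtain c where "2 ^ (p - 1) - 1 = p * c"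
    by (elim dvdE)
  then have c: "(2::nat) ^ (p - 1) = p * c + 1"
    by (metis Suc_eq_plus1 Suc_pred' pos2 zero_less_power diff_Suc_1' One_nat_def)
  have "[(2 ^ p) ^ c * 2 = 1 ^ c * 2] (mod (2 ^ p - 1 :: int))"
    by (intro cong_mult cong_pow) (auto simp: cong_iff_dvd_diff)
  then show ?thesis
    unfolding c by (simp add: power_mult mult.commute[of _ 2])
qed

text \<open>
  The power $(1 + \sqrt 3)^{M+1}$ is computed in two ways: through $(1 + \sqrt 3)^2 = 2\omega$, and
  through the Frobenius map, which sends $\sqrt 3$ to $-\sqrt 3$ because $3$ is not a square
  modulo $M$.
\<close>

lemma omega_power_if_mersenne_prime:
  assumes "prime p" "p > 2" "prime ((2::nat) ^ p - 1)"
  shows "eq_mod (2 ^ p - 1) (omega ^ (2 ^ (p - 1))) (- 1)"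
proof -
  define K :: nat where "K = 2 ^ (p - 1)"
  define M :: nat where "M = 2 ^ p - 1"
  have "(2::nat) ^ p = 2 * K" "2 ^ p = 2 * int K"
    using assms(2) by (cases p; simp add: K_def)+
  moreover have "K > 0"
    by (simp add: K_def)
  ultimately have M: "int M = 2 ^ p - 1" "M + 1 = 2 * K" "int M = 2 * int K - 1"
    by (simp_all add: M_def of_nat_diff)
  have M_half: "M = 2 * ((M - 1) div 2) + 1"
    using M(2) by presburger
  have "odd p"
    using assms prime_odd_nat by auto
  then have three: "[3 ^ ((M - 1) div 2) = - 1] (mod int M)"
    using three_power_mod_mersenne[of p] assms by (simp add: M_def)
  have "root3 ^ M = root3 ^ (2 * ((M - 1) div 2) + 1)"
    by (rule arg_cong[OF M_half])
  also have "\<dots> = of_int (3 ^ ((M - 1) div 2)) * root3"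
    by (simp add: power_mult power_add root3_square)
  also have "eq_mod (int M) \<dots> (of_int (- 1) * root3)"
    by (intro eq_mod_mult) (use three in \<open>simp_all only: eq_mod_of_int_iff eq_mod_refl\<close>)
  finally have root: "eq_mod (int M) (root3 ^ M) (- root3)"
    by simp

  have "2 ^ K * omega ^ K = ((1 + root3) ^ 2) ^ K"
    by (simp add: one_plus_root3_square power_mult_distrib)
  also have "\<dots> = (1 + root3) ^ M * (1 + root3)"
    by (metis M(2) power_add power_mult power_one_right)
  also have "eq_mod (int M) \<dots> ((1 ^ M + root3 ^ M) * (1 + root3))"
    by (intro eq_mod_mult eq_mod_prime_power_add) (use assms in \<open>auto simp: M_def\<close>)
  also have "eq_mod (int M) \<dots> ((1 + - root3) * (1 + root3))"
    by (intro eq_mod_mult eq_mod_add root) auto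
  also have "(1 + - root3) * (1 + root3) = - 2"
    by (simp add: root3_def zsqrt3_eq_iff)
  finally have "eq_mod (int M) (2 ^ K * omega ^ K) (- 2)" .
  moreover have "eq_mod (int M) (of_int (2 ^ K) * omega ^ K) (of_int 2 * omega ^ K)"
    using two_power_mod_mersenne[OF assms(1,2)]
    by (intro eq_mod_mult) (simp_all only: eq_mod_of_int_iff eq_mod_refl K_def M(1))
  ultimately have "eq_mod (int M) (2 * omega ^ K) (- 2)"
    by (auto intro: eq_mod_trans eq_mod_sym)
  \<comment> \<open>\<open>2 * K = M + 1\<close>, so \<open>K\<close> is an inverse of 2 modulo \<open>M\<close> and cancels the factor 2.\<close>
  then have "of_int (int M) dvd of_nat K * (2 * (omega ^ K + 1)) - of_int (int M) * (omega ^ K + 1)"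
    by (intro dvd_diff) (auto simp: eq_mod_def)
  also have "of_nat K * (2 * (omega ^ K + 1)) - of_int (int M) * (omega ^ K + 1) = omega ^ K + 1"
    unfolding M(3) by (simp add: algebra_simps)
  finally show ?thesis
    unfolding eq_mod_def M(1)[symmetric] K_def[symmetric] by simp
qed

theorem theorem3:
  fixes p n :: nat
  assumes "prime p" and "p \<ge> 5" and "n = 2 ^ (p - 1)"
  shows "prime ((2::nat) ^ p - 1) \<longleftrightarrow>
    (2 * int n - 1) dvd (\<Sum>k | k \<le> n div 2 \<and> even k. phi k n)"
proof -
  obtain r where r: "p = r + 2" "r > 0"
    using assms(2) that[of "p - 2"] by simp
  define j :: nat where "j = 2 ^ r"
  have j: "even j" "n = 2 * j" "n div 2 = j" "2 * int n - 1 = 2 ^ p - 1"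
    using r by (simp_all add: j_def assms(3))
  have "(2 * int n - 1) dvd (\<Sum>k | k \<le> n div 2 \<and> even k. phi k n) \<longleftrightarrow>
      eq_mod (2 ^ p - 1) (omega ^ (2 ^ (p - 1))) (- 1)"
    using dvd_even_sum_phi_iff[OF j(1), of "2 ^ p - 1"] j(2-4) assms(3) by metis
  then show ?thesis
    using mersenne_prime_if_omega_power[of p] omega_power_if_mersenne_prime[of p] assms(1,2)
    by linarith
qed

end
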